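(* For all integers $m\ge 2$ and $t\ge 1$, the group $$J_{m,t}=C_m^{\,3t}\oplus C_{2m}^{\,4t}\oplus C_{6m}^{\,t}$$ satisfies $$\delta(J_{m,t})\ge tm=\frac{\mathsf r(J_{m,t})\exp(J_{m,t})}{48}.$$
   Context: Groups are finite, abelian and written additively; $C_n$ denotes the cyclic group of order $n$. The rank $\mathsf r(G)$ is the minimum number of generators of $G$, and $\exp(G)$ is the exponent of $G$. A sequence over $G$ is a finite unordered multiset of elements of $G$; it is zero-sum free if no nonempty sub-multiset has sum $0$. $\mathsf d(G)$ is the maximum length (counted with multiplicity) of a zero-sum-free sequence over $G$. If $G\cong C_{n_1}\oplus\cdots\oplus C_{n_s}$ with $1<n_1\mid\cdots\mid n_s$, then $\mathsf d^*(G)=\sum_{i=1}^s(n_i-1)$. The Davenport excess is $\delta(G)=\mathsf d(G)-\mathsf d^*(G)$. *)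

theory Defs
  imports "HOL-Algebra.Algebra" "HOL-Library.Multiset"
begin

text \<open>
  Groups are those of \<open>HOL-Algebra\<close>, hence written multiplicatively: \<open>\<one>\<close> plays the role of
  the zero of an additive abelian group. The definitions below are meant for finite abelian groups.
\<close>

definition cyclic_sum :: "nat list \<Rightarrow> (nat \<Rightarrow> int) monoid" where
  "cyclic_sum ns = product_group {..<length ns} (\<lambda>i. integer_mod_group (ns ! i))"

definition group_rank :: "('a, 'b) monoid_scheme \<Rightarrow> nat" where
  "group_rank G = (LEAST k. \<exists>A \<subseteq> carrier G. finite A \<and> card A = k \<and> generate G A = carrier G)"

definition group_exponent :: "('a, 'b) monoid_scheme \<Rightarrow> nat" where
  "group_exponent G = (LEAST n. 0 < n \<and> (\<forall>x \<in> carrier G. x [^]\<^bsub>G\<^esub> n = \<one>\<^bsub>G\<^esub>))"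

definition seq_sum :: "('a, 'b) monoid_scheme \<Rightarrow> 'a multiset \<Rightarrow> 'a" where
  "seq_sum G S = (\<Otimes>\<^bsub>G\<^esub>x \<in> set_mset S. x [^]\<^bsub>G\<^esub> count S x)"

definition zero_sum_free :: "('a, 'b) monoid_scheme \<Rightarrow> 'a multiset \<Rightarrow> bool" where
  "zero_sum_free G S \<longleftrightarrow>
     set_mset S \<subseteq> carrier G \<and> (\<forall>T. T \<subseteq># S \<and> T \<noteq> {#} \<longrightarrow> seq_sum G T \<noteq> \<one>\<^bsub>G\<^esub>)"

text \<open>For finite \<open>G\<close> the lengths are bounded by the order of \<open>G\<close>, so the maximum exists.\<close>

definition davenport_d :: "('a, 'b) monoid_scheme \<Rightarrow> nat" where
  "davenport_d G = Max {size S | S. zero_sum_free G S}"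

definition invariant_factors :: "('a, 'b) monoid_scheme \<Rightarrow> nat list \<Rightarrow> bool" where
  "invariant_factors G ns \<longleftrightarrow>
     (\<forall>n \<in> set ns. 1 < n) \<and> sorted_wrt (dvd) ns \<and> G \<cong> cyclic_sum ns"

text \<open>The invariant factors of a finite abelian group exist and are unique.\<close>

definition davenport_d_star :: "('a, 'b) monoid_scheme \<Rightarrow> nat" where
  "davenport_d_star G = (THE d. \<exists>ns. invariant_factors G ns \<and> d = (\<Sum>n\<leftarrow>ns. n - 1))"

definition davenport_excess :: "('a, 'b) monoid_scheme \<Rightarrow> int" where
  "davenport_excess G = int (davenport_d G) - int (davenport_d_star G)"

definition J_group :: "nat \<Rightarrow> nat \<Rightarrow> (nat \<Rightarrow> int) monoid" where
  "J_group m t =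
     cyclic_sum (replicate (3 * t) m @ replicate (4 * t) (2 * m) @ replicate t (6 * m))"

end

theory Submission
  imports Defs
begin

text \<open>
  A family of \<open>r\<close> elements with multiplicities \<open>b\<^sub>i\<close> is zero-sum free iff its relation lattice in
  \<open>\<int>\<^sup>r\<close> meets the box \<open>\<Prod> [0, b\<^sub>i]\<close> only in \<open>0\<close>. Scaling the lattice by \<open>m\<close> allows the multiplicities
  \<open>m (b\<^sub>i + 1) - 1\<close>. The starting point is a zero-sum free sequence of length 10 over \<open>C\<^sub>2\<^sup>4 \<oplus> C\<^sub>6\<close> with
  eight distinct elements: seven of multiplicity 1, whose relations modulo 2 form the \<open>[7, 3]\<close> simplex
  code, and one of multiplicity 3. It yields a sequence of length \<open>10 m + 8 (m - 1)\<close> over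
  \<open>C\<^sub>m\<^sup>3 \<oplus> C\<^sub>2\<^sub>m\<^sup>4 \<oplus> C\<^sub>6\<^sub>m\<close>, which beats \<open>d\<^sup>*\<close> by \<open>m\<close>; the direct sum of \<open>t\<close> copies beats it by \<open>t m\<close>.
\<close>

section \<open>Arithmetic in sums of cyclic groups\<close>

lemma comm_group_cyclic_sum: "comm_group (cyclic_sum ns)"
proof (rule group.group_comm_groupI)
  show "group (cyclic_sum ns)"
    by (simp add: cyclic_sum_def)
qed (auto simp: cyclic_sum_def add.commute)

lemma carrier_cyclic_sum:
  assumes "\<forall>n\<in>set ns. 0 < n"
  shows "carrier (cyclic_sum ns) = (\<Pi>\<^sub>E i\<in>{..<length ns}. {0..<int (ns ! i)})"
proof -
  have "carrier (integer_mod_group (ns ! i)) = {0..<int (ns ! i)}" if "i < length ns" for i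
    using assms that by (auto simp: carrier_integer_mod_group)
  then show ?thesis
    unfolding cyclic_sum_def carrier_product_group by (intro PiE_cong) auto
qed

lemma finite_carrier_cyclic_sum:
  assumes "\<forall>n\<in>set ns. 0 < n"
  shows "finite (carrier (cyclic_sum ns))"
  using assms by (simp add: carrier_cyclic_sum finite_PiE)

lemma one_cyclic_sum: "\<one>\<^bsub>cyclic_sum ns\<^esub> = (\<lambda>i\<in>{..<length ns}. 0)"
  by (simp add: cyclic_sum_def)

lemma mult_cyclic_sum:
  "x \<otimes>\<^bsub>cyclic_sum ns\<^esub> y = (\<lambda>i\<in>{..<length ns}. (x i + y i) mod int (ns ! i))"
  by (simp add: cyclic_sum_def)

lemma inv_cyclic_sum:
  assumes "x \<in> carrier (cyclic_sum ns)"
  shows "inv\<^bsub>cyclic_sum ns\<^esub> x = (\<lambda>i\<in>{..<length ns}. - x i mod int (ns ! i))"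
  using assms by (auto simp: cyclic_sum_def PiE_iff intro!: restrict_ext)

lemma nat_pow_cyclic_sum:
  "x [^]\<^bsub>cyclic_sum ns\<^esub> (k::nat) = (\<lambda>i\<in>{..<length ns}. (int k * x i) mod int (ns ! i))"
  by (induction k) 
     (auto simp: one_cyclic_sum mult_cyclic_sum mod_simps algebra_simps fun_eq_iff restrict_def)

lemma finprod_cyclic_sum:
  assumes "finite I" "f \<in> I \<rightarrow> carrier (cyclic_sum ns)"
  shows "finprod (cyclic_sum ns) f I = (\<lambda>j\<in>{..<length ns}. (\<Sum>i\<in>I. f i j) mod int (ns ! j))"
proof -
  interpret comm_group "cyclic_sum ns" by (rule comm_group_cyclic_sum)
  from assms show ?thesis
  proof (induction I rule: finite_induct)
    case empty
    then show ?case by (simp add: one_cyclic_sum)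
  next
    case (insert a I)
    then show ?case
      by (auto simp: mult_cyclic_sum mod_add_right_eq intro!: restrict_ext)
  qed
qed

text \<open>\<open>seq_sum\<close> runs over the support with multiplicities; this passes to a sum
  over the multiset itself. The finite set \<open>A\<close> may exceed the support, so that it can
  later be a whole index set.\<close>

lemma sum_count_eq_sum_mset:
  fixes f :: "'a \<Rightarrow> 'b::comm_semiring_1"
  assumes "finite A" "set_mset T \<subseteq> A"
  shows "(\<Sum>a\<in>A. of_nat (count T a) * f a) = (\<Sum>a\<in>#T. f a)"
  using assms(2)
proof (induction T)
  case (add b T)
  have "(\<Sum>a\<in>A. of_nat (count (add_mset b T) a) * f a)
      = (\<Sum>a\<in>A. (if a = b then f a else 0) + of_nat (count T a) * f a)"
    by (intro sum.cong) (auto simp: algebra_simps)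
  also have "\<dots> = f b + (\<Sum>a\<in>A. of_nat (count T a) * f a)"
    using add.prems assms(1) by (simp add: sum.distrib)
  finally show ?case using add by simp
qed simp

lemma seq_sum_cyclic_sum:
  assumes "set_mset T \<subseteq> carrier (cyclic_sum ns)"
  shows "seq_sum (cyclic_sum ns) T = (\<lambda>j\<in>{..<length ns}. (\<Sum>g\<in>#T. g j) mod int (ns ! j))"
proof -
  interpret comm_group "cyclic_sum ns" by (rule comm_group_cyclic_sum)
  have "seq_sum (cyclic_sum ns) T =
      (\<lambda>j\<in>{..<length ns}.
        (\<Sum>g\<in>set_mset T. (g [^]\<^bsub>cyclic_sum ns\<^esub> count T g) j) mod int (ns ! j))"
    unfolding seq_sum_def using assms by (intro finprod_cyclic_sum) auto
  also have "\<dots> = (\<lambda>j\<in>{..<length ns}.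
        (\<Sum>g\<in>set_mset T. int (count T g) * g j) mod int (ns ! j))"
    by (intro restrict_ext) (simp add: nat_pow_cyclic_sum mod_sum_eq)
  finally show ?thesis
    by (simp add: sum_count_eq_sum_mset)
qed

section \<open>Lower bounds for the Davenport constant\<close>

text \<open>\<open>order G\<close> copies of one element already have trivial sum, which bounds
  every multiplicity in \<open>S\<close>. The bound makes the set under \<open>Max\<close> in
  \<open>davenport_d\<close> finite.\<close>

lemma (in comm_group) zero_sum_free_size_le:
  assumes "finite (carrier G)" "zero_sum_free G S"
  shows "size S \<le> card (carrier G) * order G"
proof -
  have sub: "set_mset S \<subseteq> carrier G"
    using assms(2) by (simp add: zero_sum_free_def)
  have "count S x \<le> order G" if "x \<in> set_mset S" for x
  proof (rule ccontr)
    assume "\<not> count S x \<le> order G"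
    then have "replicate_mset (order G) x \<subseteq># S"
      by (auto simp: subseteq_mset_def)
    moreover have "0 < order G"
      using assms(1) by (simp add: order_gt_0_iff_finite)
    moreover have "seq_sum G (replicate_mset (order G) x) = \<one>"
      using \<open>0 < order G\<close> that sub pow_order_eq_1 [of x]
      by (auto simp: seq_sum_def)
    ultimately show False
      using assms(2) by (auto simp: zero_sum_free_def)
  qed
  then have "size S \<le> (\<Sum>x\<in>set_mset S. order G)"
    unfolding size_multiset_overloaded_eq by (rule sum_mono)
  also have "\<dots> \<le> card (carrier G) * order G"
    using card_mono [OF assms(1) sub] by simp
  finally show ?thesis .
qed

lemma (in comm_group) davenport_d_ge:
  assumes "finite (carrier G)" "zero_sum_free G S"
  shows "size S \<le> davenport_d G"
proof -
  have "{size S |S. zero_sum_free G S} \<subseteq> {..card (carrier G) * order G}"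
    using zero_sum_free_size_le [OF assms(1)] by auto
  then have "finite {size S |S. zero_sum_free G S}"
    using finite_subset by blast
  then show ?thesis
    unfolding davenport_d_def using assms(2) by (intro Max_ge) auto
qed

text \<open>A nonempty zero-sum subsequence taking the element of index \<open>i\<close> exactly
  \<open>x i\<close> times would be a nonzero relation inside the box. The criterion is thus checked
  on integer vectors, before reduction modulo the orders.\<close>

lemma davenport_d_cyclic_sum_ge:
  fixes h :: "'i \<Rightarrow> nat \<Rightarrow> int" and b :: "'i \<Rightarrow> nat"
  assumes pos: "\<forall>n\<in>set ns. 0 < n" and "finite I"
    and free: "\<And>x. \<lbrakk>\<And>i. i \<in> I \<Longrightarrow> x i \<le> b i;
        \<And>j. j < length ns \<Longrightarrow> int (ns ! j) dvd (\<Sum>i\<in>I. int (x i) * h i j)\<rbrakk>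
      \<Longrightarrow> \<forall>i\<in>I. x i = 0"
  shows "(\<Sum>i\<in>I. b i) \<le> davenport_d (cyclic_sum ns)"
proof -
  interpret comm_group "cyclic_sum ns" by (rule comm_group_cyclic_sum)
  define g where "g i = (\<lambda>j\<in>{..<length ns}. h i j mod int (ns ! j))" for i
  define M where "M = (\<Sum>i\<in>I. replicate_mset (b i) i)"
  have g_carrier: "g i \<in> carrier (cyclic_sum ns)" for i
    using pos by (auto simp: carrier_cyclic_sum g_def)
  have count_M: "count M i = (if i \<in> I then b i else 0)" for i
    using \<open>finite I\<close> by (simp add: M_def count_sum)
  have "zero_sum_free (cyclic_sum ns) (image_mset g M)"
    unfolding zero_sum_free_def
  proof (intro conjI allI impI notI)
    show "set_mset (image_mset g M) \<subseteq> carrier (cyclic_sum ns)"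
      using g_carrier by auto
  next
    fix T
    assume T: "T \<subseteq># image_mset g M \<and> T \<noteq> {#}" and sum: "seq_sum (cyclic_sum ns) T = \<one>\<^bsub>cyclic_sum ns\<^esub>"
    \<comment> \<open>\<open>T\<close> is lifted to a submultiset \<open>U\<close> of the index
      multiset, because group elements alone do not record their index when \<open>g\<close> is not
      injective.\<close>
    from T obtain R where "image_mset g M = T + R"
      using subset_mset.le_iff_add by blast
    then obtain U V where UV: "M = U + V" "image_mset g U = T"
      using image_mset_eq_plusD by metis
    have U_I: "set_mset U \<subseteq> I"
      using UV(1) count_M by (metis count_greater_zero_iff less_irrefl subsetI union_iff)
    have "int (ns ! j) dvd (\<Sum>i\<in>I. int (count U i) * h i j)" if j: "j < length ns" for j
    proof -
      have "0 = seq_sum (cyclic_sum ns) T j"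
        using j sum by (simp add: one_cyclic_sum)
      also have "\<dots> = (\<Sum>i\<in>#U. g i j) mod int (ns ! j)"
        using j g_carrier UV(2)
        by (subst seq_sum_cyclic_sum) (auto simp: image_mset.compositionality o_def)
      also have "(\<Sum>i\<in>#U. g i j) = (\<Sum>i\<in>I. int (count U i) * g i j)"
        using sum_count_eq_sum_mset [OF \<open>finite I\<close> U_I, of "\<lambda>i. g i j"] by simp
      also have "\<dots> mod int (ns ! j) = (\<Sum>i\<in>I. int (count U i) * h i j) mod int (ns ! j)"
        using j by (subst (1 2) mod_sum_eq [symmetric]) (simp add: g_def mod_mult_right_eq)
      finally show ?thesis by (simp add: dvd_eq_mod_eq_0)
    qed
    moreover have "count U i \<le> b i" if "i \<in> I" for i
      using that count_M [of i] UV(1) by simp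
    ultimately have "\<forall>i\<in>I. count U i = 0"
      by (intro free) auto
    with U_I have "U = {#}"
      by (metis count_greater_zero_iff less_irrefl multiset_nonemptyE subsetD)
    with T UV(2) show False by simp
  qed
  then have "size (image_mset g M) \<le> davenport_d (cyclic_sum ns)"
    using finite_carrier_cyclic_sum [OF pos] by (intro davenport_d_ge)
  moreover have "size M = (\<Sum>i\<in>I. b i)"
    unfolding M_def using \<open>finite I\<close> by (induction I rule: finite_induct) auto
  ultimately show ?thesis by simp
qed

section \<open>Uniqueness of invariant factors\<close>

text \<open>Multiplication by \<open>n\<close> modulo \<open>k\<close> kills exactly the multiples
  of \<open>k / gcd n k\<close>, and \<open>gcd n k\<close> of these lie in
  \<open>{0..<int k}\<close>.\<close>

lemma card_multiples_eq_zero_mod: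
  fixes k n :: nat
  assumes "0 < k"
  shows "card {x \<in> {0..<int k}. int n * x mod int k = 0} = gcd n k"
proof -
  define g where "g = gcd n k"
  have "gcd n k \<noteq> 0" using assms by simp
  then obtain n' k' where nk: "n = g * n'" "k = g * k'" "coprime n' k'"
    unfolding g_def using gcd_coprime_exists [of n k] by (metis mult.commute)
  have g: "0 < g" and k': "0 < k'"
    using assms nk by auto
  have "int n * x mod int k = 0 \<longleftrightarrow> int k' dvd x" for x
  proof -
    have "int n * x mod int k = 0 \<longleftrightarrow> int g * int k' dvd int g * (int n' * x)"
      by (simp add: nk dvd_eq_mod_eq_0 mult.assoc)
    also have "\<dots> \<longleftrightarrow> int k' dvd int n' * x"
      using g by simp
    also have "\<dots> \<longleftrightarrow> int k' dvd x"
      using nk(3) by (simp add: coprime_dvd_mult_right_iff coprime_commute)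
    finally show ?thesis .
  qed
  then have "{x \<in> {0..<int k}. int n * x mod int k = 0} = (\<lambda>y. int k' * y) ` {0..<int g}"
  proof (intro equalityI subsetI)
    fix x assume "x \<in> {x \<in> {0..<int k}. int n * x mod int k = 0}"
    then have x: "0 \<le> x" "x < int k" "int k' dvd x"
      using \<open>\<And>x. (int n * x mod int k = 0) = (int k' dvd x)\<close> by auto
    then obtain y where y: "x = int k' * y" by (elim dvdE)
    with x k' have "0 \<le> y" "y < int g"
      by (simp_all add: nk(2) zero_le_mult_iff mult.commute)
    then show "x \<in> (\<lambda>y. int k' * y) ` {0..<int g}"
      unfolding y by (intro imageI) simp
  next
    fix x assume "x \<in> (\<lambda>y. int k' * y) ` {0..<int g}"
    then obtain y where "x = int k' * y" "y \<in> {0..<int g}" by blast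
    with k' show "x \<in> {x \<in> {0..<int k}. int n * x mod int k = 0}"
      using \<open>\<And>x. (int n * x mod int k = 0) = (int k' dvd x)\<close>
      by (simp add: nk(2) mult.commute)
  qed
  moreover have "inj_on (\<lambda>y. int k' * y) {0..<int g}"
    using k' by (auto simp: inj_on_def)
  ultimately show ?thesis
    by (simp add: card_image g_def)
qed

text \<open>The \<open>n\<close>-torsion of a direct sum is the product of the
  \<open>n\<close>-torsions of the summands. These counts are the isomorphism invariants from which
  the invariant factors are recovered.\<close>

lemma card_torsion_cyclic_sum:
  assumes "\<forall>k\<in>set ns. 0 < k"
  shows "card {x \<in> carrier (cyclic_sum ns). x [^]\<^bsub>cyclic_sum ns\<^esub> (n::nat) = \<one>\<^bsub>cyclic_sum ns\<^esub>}
    = (\<Prod>k\<leftarrow>ns. gcd n k)"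
proof -
  have torsion_iff: "x [^]\<^bsub>cyclic_sum ns\<^esub> n = \<one>\<^bsub>cyclic_sum ns\<^esub>
      \<longleftrightarrow> (\<forall>i\<in>{..<length ns}. int n * x i mod int (ns ! i) = 0)" for x
  proof
    assume eq: "x [^]\<^bsub>cyclic_sum ns\<^esub> n = \<one>\<^bsub>cyclic_sum ns\<^esub>"
    show "\<forall>i\<in>{..<length ns}. int n * x i mod int (ns ! i) = 0"
    proof
      fix i assume "i \<in> {..<length ns}"
      with fun_cong [OF eq, of i] show "int n * x i mod int (ns ! i) = 0"
        by (simp add: nat_pow_cyclic_sum one_cyclic_sum)
    qed
  next
    assume "\<forall>i\<in>{..<length ns}. int n * x i mod int (ns ! i) = 0"
    then show "x [^]\<^bsub>cyclic_sum ns\<^esub> n = \<one>\<^bsub>cyclic_sum ns\<^esub>"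
      unfolding nat_pow_cyclic_sum one_cyclic_sum by (intro restrict_ext) blast
  qed
  have "{x \<in> carrier (cyclic_sum ns). x [^]\<^bsub>cyclic_sum ns\<^esub> n = \<one>\<^bsub>cyclic_sum ns\<^esub>}
      = (\<Pi>\<^sub>E i\<in>{..<length ns}. {x \<in> {0..<int (ns ! i)}. int n * x mod int (ns ! i) = 0})"
    unfolding carrier_cyclic_sum [OF assms] torsion_iff
    by (simp only: set_eq_iff mem_Collect_eq PiE_iff ball_conj_distrib conj_ac simp_thms)
  then have "card {x \<in> carrier (cyclic_sum ns). x [^]\<^bsub>cyclic_sum ns\<^esub> n = \<one>\<^bsub>cyclic_sum ns\<^esub>}
      = (\<Prod>i<length ns. card {x \<in> {0..<int (ns ! i)}. int n * x mod int (ns ! i) = 0})"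
    by (simp only: card_PiE finite_lessThan)
  also have "\<dots> = (\<Prod>i<length ns. gcd n (ns ! i))"
    using assms by (intro prod.cong refl card_multiples_eq_zero_mod) simp
  also have "\<dots> = (\<Prod>k\<leftarrow>ns. gcd n k)"
    by (subst prod.list_conv_set_nth) (simp add: atLeast0LessThan)
  finally show ?thesis .
qed

lemma iso_card_torsion_eq:
  assumes "group G" "group H" "G \<cong> H"
  shows "card {x \<in> carrier G. x [^]\<^bsub>G\<^esub> (n::nat) = \<one>\<^bsub>G\<^esub>} = card {x \<in> carrier H. x [^]\<^bsub>H\<^esub> n = \<one>\<^bsub>H\<^esub>}"
proof -
  from assms(3) obtain f where f: "f \<in> iso G H" by (auto simp: is_iso_def)
  interpret group_hom G H f
    using assms(1,2) f by (simp add: group_hom_def group_hom_axioms_def iso_def)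
  have inj: "inj_on f (carrier G)" and surj: "f ` carrier G = carrier H"
    using f by (auto simp: iso_def bij_betw_def)
  have "f (x [^]\<^bsub>G\<^esub> n) = \<one>\<^bsub>H\<^esub> \<longleftrightarrow> x [^]\<^bsub>G\<^esub> n = \<one>\<^bsub>G\<^esub>" if "x \<in> carrier G" for x
    using inj that by (metis G.nat_pow_closed G.one_closed hom_one inj_onD)
  then have "f ` {x \<in> carrier G. x [^]\<^bsub>G\<^esub> n = \<one>\<^bsub>G\<^esub>} = {x \<in> carrier H. x [^]\<^bsub>H\<^esub> n = \<one>\<^bsub>H\<^esub>}"
    unfolding surj [symmetric] by (auto simp: hom_nat_pow)
  then show ?thesis
    using card_image [OF inj_on_subset [OF inj]] by (metis (no_types, lifting) mem_Collect_eq subsetI)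
qed

section \<open>Recovering a divisor chain from its gcd products\<close>

lemma prod_list_gcd_le:
  "(\<Prod>k\<leftarrow>ns. gcd (a::nat) k) \<le> a ^ length ns" if "0 < a"
proof (induction ns)
  case (Cons k ns)
  with that show ?case
    by (simp add: mult_le_mono gcd_le1_nat)
qed simp

text \<open>Every factor is at most \<open>a\<close>, so a product that attains the maximal power
  leaves no room for a smaller gcd.\<close>

lemma prod_list_gcd_eq_power:
  assumes "0 < a" "(\<Prod>k\<leftarrow>ns. gcd (a::nat) k) = a ^ length ns"
  shows "\<forall>k\<in>set ns. a dvd k"
  using assms(2)
proof (induction ns)
  case (Cons k ns)
  have le: "gcd a k \<le> a" "(\<Prod>k\<leftarrow>ns. gcd a k) \<le> a ^ length ns"
    using assms(1) prod_list_gcd_le by auto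
  have eq: "gcd a k * (\<Prod>k\<leftarrow>ns. gcd a k) = a * a ^ length ns"
    using Cons.prems by simp
  have "gcd a k = a"
  proof (rule ccontr)
    assume "gcd a k \<noteq> a"
    with le(1) have "gcd a k < a" by simp
    with assms(1) have "gcd a k * a ^ length ns < a * a ^ length ns"
      by simp
    moreover have "gcd a k * (\<Prod>k\<leftarrow>ns. gcd a k) \<le> gcd a k * a ^ length ns"
      using le(2) by (rule mult_le_mono2)
    ultimately show False using eq by linarith
  qed
  with eq assms(1) Cons.IH show ?case
    by (metis gcd_dvd2 less_not_refl mult_cancel1 set_ConsD)
qed simp

lemma prod_list_gcd_of_dvd:
  "\<forall>k\<in>set ns. a dvd k \<Longrightarrow> (\<Prod>k\<leftarrow>ns. gcd (a::nat) k) = a ^ length ns"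
  by (induction ns) (auto simp: gcd_nat.absorb1)

lemma sorted_wrt_dvd_replicate: "sorted_wrt (dvd) (replicate k (n::nat))"
  by (induction k) auto

text \<open>Taking \<open>n\<close> to be the head of one chain makes its product the maximal power,
  so that head divides every entry of the other chain. By symmetry the heads divide each other and
  coincide; their positive gcd factor cancels, and the tails follow by induction.\<close>

lemma divisor_chains_eqI:
  fixes ns ns' :: "nat list"
  assumes "length ns = length ns'" "sorted_wrt (dvd) ns" "sorted_wrt (dvd) ns'"
    "\<forall>k\<in>set ns. 0 < k" "\<forall>k\<in>set ns'. 0 < k"
    "\<And>n. (\<Prod>k\<leftarrow>ns. gcd n k) = (\<Prod>k\<leftarrow>ns'. gcd n k)"
  shows "ns = ns'"
  using assms
proof (induction ns ns' rule: list_induct2)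
  case (Cons a ns a' ns')
  have "(\<Prod>k\<leftarrow>a # ns. gcd a k) = a ^ length (a # ns)" 
    using Cons.prems by (intro prod_list_gcd_of_dvd) auto
  then have "(\<Prod>k\<leftarrow>a' # ns'. gcd a k) = a ^ length (a' # ns')"
    using Cons.prems(5) [of a] Cons.hyps by (simp only: length_Cons)
  then have "\<forall>k\<in>set (a' # ns'). a dvd k"
    using Cons.prems(3) by (intro prod_list_gcd_eq_power) auto
  moreover have "(\<Prod>k\<leftarrow>a' # ns'. gcd a' k) = a' ^ length (a' # ns')" 
    using Cons.prems by (intro prod_list_gcd_of_dvd) auto
  then have "(\<Prod>k\<leftarrow>a # ns. gcd a' k) = a' ^ length (a # ns)"
    using Cons.prems(5) [of a'] Cons.hyps by (simp only: length_Cons)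
  then have "\<forall>k\<in>set (a # ns). a' dvd k"
    using Cons.prems(4) by (intro prod_list_gcd_eq_power) auto
  ultimately have "a = a'"
    by (simp add: dvd_antisym)
  moreover have "(\<Prod>k\<leftarrow>ns. gcd n k) = (\<Prod>k\<leftarrow>ns'. gcd n k)" for n
    using Cons.prems(5) [of n] Cons.prems(3) \<open>a = a'\<close> by simp
  then have "ns = ns'"
    using Cons.prems by (intro Cons.IH) auto
  ultimately show ?case by simp
qed simp

lemma invariant_factors_unique:
  assumes "group G" "invariant_factors G ns" "invariant_factors G ns'"
  shows "ns = ns'"
proof -
  \<comment> \<open>Leading ones bring both lists to a common length. They keep the divisibility
    chain, contribute only factors \<open>gcd n 1 = 1\<close>, and can be filtered out again because
    genuine invariant factors exceed 1.\<close>
  define pad where "pad xs = replicate (length ns + length ns' - length xs) 1 @ xs" for xs :: "nat list"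
  have gt: "\<forall>k\<in>set ns. 1 < k" "\<forall>k\<in>set ns'. 1 < k"
    using assms by (auto simp: invariant_factors_def)
  have "(\<Prod>k\<leftarrow>ns. gcd n k) = (\<Prod>k\<leftarrow>ns'. gcd n k)" for n
  proof -
    have "G \<cong> cyclic_sum ns" "G \<cong> cyclic_sum ns'"
      using assms(2,3) by (simp_all add: invariant_factors_def)
    then have "cyclic_sum ns \<cong> cyclic_sum ns'"
      using group.iso_sym [OF assms(1)] iso_trans by metis
    then have "card {x \<in> carrier (cyclic_sum ns). x [^]\<^bsub>cyclic_sum ns\<^esub> n = \<one>\<^bsub>cyclic_sum ns\<^esub>}
        = card {x \<in> carrier (cyclic_sum ns'). x [^]\<^bsub>cyclic_sum ns'\<^esub> n = \<one>\<^bsub>cyclic_sum ns'\<^esub>}"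
      by (intro iso_card_torsion_eq comm_group.axioms(2) comm_group_cyclic_sum)
    moreover have "\<forall>k\<in>set ns. 0 < k" "\<forall>k\<in>set ns'. 0 < k"
      using gt by force+
    ultimately show ?thesis
      by (simp add: card_torsion_cyclic_sum)
  qed
  then have "pad ns = pad ns'"
    using assms gt
    by (intro divisor_chains_eqI)
       (auto simp: pad_def sorted_wrt_append sorted_wrt_dvd_replicate invariant_factors_def prod_list_replicate)
  then have "filter (\<lambda>k. k \<noteq> 1) (pad ns) = filter (\<lambda>k. k \<noteq> 1) (pad ns')"
    by simp
  moreover have "filter (\<lambda>k. k \<noteq> 1) ns = ns" "filter (\<lambda>k. k \<noteq> 1) ns' = ns'"
    using gt by (auto simp: filter_id_conv)
  ultimately show ?thesis
    by (simp add: pad_def)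
qed

lemma davenport_d_star_eq:
  assumes "group G" "invariant_factors G ns"
  shows "davenport_d_star G = (\<Sum>n\<leftarrow>ns. n - 1)"
  unfolding davenport_d_star_def
proof (rule the_equality)
  show "\<exists>ns'. invariant_factors G ns' \<and> (\<Sum>n\<leftarrow>ns. n - 1) = (\<Sum>n\<leftarrow>ns'. n - 1)"
    using assms(2) by blast
  show "d = (\<Sum>n\<leftarrow>ns. n - 1)" if "\<exists>ns'. invariant_factors G ns' \<and> d = (\<Sum>n\<leftarrow>ns'. n - 1)" for d
    using that invariant_factors_unique [OF assms] by blast
qed

section \<open>Rank and exponent\<close>

text \<open>Since \<open>m\<close> divides every order, reducing all coordinates modulo
  \<open>m\<close> is a well-defined homomorphism, which turns group products and inverses into sums
  and negatives of the coefficients \<open>e\<close>.\<close>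

lemma generate_cyclic_sum_cong:
  assumes "finite A" "A \<subseteq> carrier (cyclic_sum ns)" "\<forall>n\<in>set ns. m dvd n"
    and "g \<in> generate (cyclic_sum ns) A"
  shows "\<exists>e. \<forall>i<length ns. g i mod int m = (\<Sum>a\<in>A. e a * a i) mod int m"
  using assms(4)
proof (induction g rule: generate.induct)
  case one
  show ?case
    by (rule exI [of _ "\<lambda>_. 0"]) (simp add: one_cyclic_sum)
next
  case (incl h)
  then show ?case
    using assms(1) by (intro exI [of _ "\<lambda>a. if a = h then 1 else 0"]) (simp add: if_distrib [of "\<lambda>u. u * _"] cong: if_cong)
next
  case (inv h)
  then have "inv\<^bsub>cyclic_sum ns\<^esub> h = (\<lambda>i\<in>{..<length ns}. - h i mod int (ns ! i))"
    using assms(2) by (intro inv_cyclic_sum) auto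
  with inv show ?case
    using assms(1,3)
    by (intro exI [of _ "\<lambda>a. if a = h then -1 else 0"])
       (simp add: if_distrib [of "\<lambda>u. u * _"] mod_mod_cancel cong: if_cong)
next
  case (eng g h)
  then obtain e f where 
    e: "\<forall>i<length ns. g i mod int m = (\<Sum>a\<in>A. e a * a i) mod int m" and
    f: "\<forall>i<length ns. h i mod int m = (\<Sum>a\<in>A. f a * a i) mod int m"
    by blast
  have "(g \<otimes>\<^bsub>cyclic_sum ns\<^esub> h) i mod int m = (\<Sum>a\<in>A. (e a + f a) * a i) mod int m"
    if "i < length ns" for i
  proof -
    have "(g \<otimes>\<^bsub>cyclic_sum ns\<^esub> h) i mod int m = (g i + h i) mod int m"
      using that assms(3) by (simp add: mult_cyclic_sum mod_mod_cancel)
    also have "\<dots> = ((\<Sum>a\<in>A. e a * a i) + (\<Sum>a\<in>A. f a * a i)) mod int m"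
      using e f that by (intro mod_add_cong) auto
    finally show ?thesis by (simp add: sum.distrib distrib_right)
  qed
  then show ?case by (intro exI [of _ "\<lambda>a. e a + f a"]) simp
qed

text \<open>Modulo \<open>m\<close>, a set of \<open>k\<close> elements has at most \<open>m ^ k\<close> distinct combinations.\<close>

lemma card_generating_set_cyclic_sum_ge:
  assumes m: "1 < m" and dvd: "\<forall>n\<in>set ns. m dvd n" and pos: "\<forall>n\<in>set ns. 0 < n"
    and A: "finite A" "A \<subseteq> carrier (cyclic_sum ns)" "generate (cyclic_sum ns) A = carrier (cyclic_sum ns)"
  shows "length ns \<le> card A"
proof -
  let ?red = "\<lambda>e. \<lambda>i\<in>{..<length ns}. (\<Sum>a\<in>A. e a * a i) mod int m"
  have "(\<Pi>\<^sub>E i\<in>{..<length ns}. {0..<int m}) \<subseteq> ?red ` (\<Pi>\<^sub>E a\<in>A. {0..<int m})"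
  proof
    \<comment> \<open>Each order is at least \<open>m\<close>, so the residue vector
      \<open>g\<close> is itself a group element and therefore a combination of the generators
      modulo \<open>m\<close>; its coefficients may then be reduced modulo \<open>m\<close>.\<close>
    fix g assume g: "g \<in> (\<Pi>\<^sub>E i\<in>{..<length ns}. {0..<int m})"
    have le: "m \<le> ns ! i" if "i < length ns" for i
      using that dvd pos by (simp add: dvd_imp_le)
    have "g \<in> carrier (cyclic_sum ns)"
      using g le unfolding carrier_cyclic_sum [OF pos]
      by (force simp: PiE_iff)
    then obtain e where e: "\<forall>i<length ns. g i mod int m = (\<Sum>a\<in>A. e a * a i) mod int m"
      using generate_cyclic_sum_cong [OF A(1,2) dvd] A(3) by blast
    have "g i = ?red (\<lambda>a\<in>A. e a mod int m) i" for i
    proof (cases "i < length ns")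
      case True
      with g have "g i = g i mod int m"
        by (auto simp: PiE_iff)
      also have "\<dots> = (\<Sum>a\<in>A. e a * a i) mod int m"
        using e True by blast
      also have "\<dots> = (\<Sum>a\<in>A. (e a mod int m) * a i) mod int m"
        by (subst (1 2) mod_sum_eq [symmetric]) (simp add: mod_mult_left_eq)
      finally show ?thesis using True by (simp cong: sum.cong)
    next
      case False
      with g show ?thesis by (auto simp: PiE_iff extensional_def)
    qed
    then have "g = ?red (\<lambda>a\<in>A. e a mod int m)" by blast
    moreover have "(\<lambda>a\<in>A. e a mod int m) \<in> (\<Pi>\<^sub>E a\<in>A. {0..<int m})"
      using m by auto
    ultimately show "g \<in> ?red ` (\<Pi>\<^sub>E a\<in>A. {0..<int m})" by blast
  qed
  then have "card (\<Pi>\<^sub>E i\<in>{..<length ns}. {0..<int m}) \<le> card (\<Pi>\<^sub>E a\<in>A. {0..<int m})"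
    using A(1) by (meson card_image_le card_mono finite_PiE finite_atLeastLessThan_int finite_imageI le_trans)
  then have "m ^ length ns \<le> m ^ card A"
    using A(1) by (simp add: card_PiE)
  with m show ?thesis by simp
qed

text \<open>The restriction to \<open>{..<r}\<close> gives the extensional functions that the
  carrier of \<open>product_group\<close> consists of.\<close>

definition std_gen :: "nat \<Rightarrow> nat \<Rightarrow> nat \<Rightarrow> int" where
  "std_gen r i = (\<lambda>j\<in>{..<r}. if j = i then 1 else 0)"

lemma std_gen_carrier:
  assumes "\<forall>n\<in>set ns. 1 < n"
  shows "std_gen (length ns) i \<in> carrier (cyclic_sum ns)"
proof -
  have "\<forall>n\<in>set ns. 0 < n" using assms by auto
  with assms show ?thesis
    by (auto simp: std_gen_def carrier_cyclic_sum PiE_iff)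
qed

text \<open>An element \<open>x\<close> is the product of the powers of the standard generators with
  exponents \<open>x i\<close>; these are nonnegative representatives, so \<open>nat\<close> loses
  nothing.\<close>

lemma generate_std_gens:
  assumes gt: "\<forall>n\<in>set ns. 1 < n"
  shows "generate (cyclic_sum ns) (std_gen (length ns) ` {..<length ns}) = carrier (cyclic_sum ns)"
proof
  interpret comm_group "cyclic_sum ns" by (rule comm_group_cyclic_sum)
  let ?A = "std_gen (length ns) ` {..<length ns}"
  have A: "?A \<subseteq> carrier (cyclic_sum ns)"
    using std_gen_carrier [OF gt] by auto
  then show "generate (cyclic_sum ns) ?A \<subseteq> carrier (cyclic_sum ns)"
    by (rule generate_incl)
  interpret H: subgroup "generate (cyclic_sum ns) ?A" "cyclic_sum ns"
    using A by (rule generate_is_subgroup)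
  show "carrier (cyclic_sum ns) \<subseteq> generate (cyclic_sum ns) ?A"
  proof
    fix x assume "x \<in> carrier (cyclic_sum ns)"
    moreover have "\<forall>n\<in>set ns. 0 < n" using gt by auto
    ultimately have x: "x \<in> (\<Pi>\<^sub>E i\<in>{..<length ns}. {0..<int (ns ! i)})"
      by (simp add: carrier_cyclic_sum)
    let ?f = "\<lambda>i. std_gen (length ns) i [^]\<^bsub>cyclic_sum ns\<^esub> nat (x i)"
    have mem: "?f i \<in> generate (cyclic_sum ns) ?A" if "i < length ns" for i
    proof -
      have "std_gen (length ns) i \<in> generate (cyclic_sum ns) ?A"
        using that by (intro generate.incl) auto
      from subgroup_int_pow_closed [OF H.subgroup_axioms this, of "int (nat (x i))"]
      show ?thesis by (simp only: int_pow_int)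
    qed
    have "finprod (cyclic_sum ns) ?f {..<length ns} =
        (\<lambda>j\<in>{..<length ns}. (\<Sum>i<length ns. ?f i j) mod int (ns ! j))"
      using std_gen_carrier [OF gt] by (intro finprod_cyclic_sum) auto
    also have "\<dots> = x"
    proof
      fix j
      show "(\<lambda>j\<in>{..<length ns}. (\<Sum>i<length ns. ?f i j) mod int (ns ! j)) j = x j"
      proof (cases "j < length ns")
        case True
        then have xj: "0 \<le> x j" "x j < int (ns ! j)" using x by (auto simp: PiE_iff)
        have "(\<Sum>i<length ns. ?f i j) = (\<Sum>i<length ns. if i = j then x j else 0)"
          using True xj by (intro sum.cong) (auto simp: nat_pow_cyclic_sum std_gen_def)
        with True xj show ?thesis by simp
      next
        case False
        with x show ?thesis by (auto simp: PiE_iff extensional_def)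
      qed
    qed
    finally have "finprod (cyclic_sum ns) ?f {..<length ns} = x" .
    moreover have "finprod (cyclic_sum ns) ?f I \<in> generate (cyclic_sum ns) ?A"
      if "finite I" "I \<subseteq> {..<length ns}" for I
      using that
    proof (induction I rule: finite_induct)
      case (insert i I)
      then show ?case
        using mem std_gen_carrier [OF gt] by (subst finprod_insert) auto
    qed simp
    ultimately show "x \<in> generate (cyclic_sum ns) ?A"
      by (metis finite_lessThan order_refl)
  qed
qed

text \<open>The standard generators give the upper bound. The common divisor \<open>m\<close> gives
  the lower one: modulo \<open>m\<close> there are \<open>m ^ length ns\<close> residue vectors to
  be reached.\<close>

lemma group_rank_cyclic_sum:
  assumes gt: "\<forall>n\<in>set ns. 1 < n" and m: "1 < m" "\<forall>n\<in>set ns. m dvd n"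
  shows "group_rank (cyclic_sum ns) = length ns"
  unfolding group_rank_def
proof (rule Least_equality)
  have "inj_on (std_gen (length ns)) {..<length ns}"
  proof (rule inj_onI)
    fix i j assume "i \<in> {..<length ns}" "j \<in> {..<length ns}" "std_gen (length ns) i = std_gen (length ns) j"
    from this(1) fun_cong [OF this(3), of i] show "i = j"
      by (simp add: std_gen_def split: if_splits)
  qed
  then have "card (std_gen (length ns) ` {..<length ns}) = length ns"
    by (simp add: card_image)
  then show "\<exists>A\<subseteq>carrier (cyclic_sum ns). finite A \<and> card A = length ns
      \<and> generate (cyclic_sum ns) A = carrier (cyclic_sum ns)"
    using generate_std_gens [OF gt] std_gen_carrier [OF gt]
    by (intro exI [of _ "std_gen (length ns) ` {..<length ns}"]) auto
next
  fix k assume "\<exists>A\<subseteq>carrier (cyclic_sum ns). finite A \<and> card A = k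
      \<and> generate (cyclic_sum ns) A = carrier (cyclic_sum ns)"
  moreover have "\<forall>n\<in>set ns. 0 < n" using gt by auto
  ultimately show "length ns \<le> k"
    using card_generating_set_cyclic_sum_ge [OF m] by blast
qed

text \<open>\<open>N\<close> kills every summand, and the standard generator of a summand of order
  \<open>N\<close> has order exactly \<open>N\<close>.\<close>

lemma group_exponent_cyclic_sum:
  assumes gt: "\<forall>n\<in>set ns. 1 < n" and N: "N \<in> set ns" "\<forall>n\<in>set ns. n dvd N"
  shows "group_exponent (cyclic_sum ns) = N"
  unfolding group_exponent_def
proof (rule Least_equality)
  show "0 < N \<and> (\<forall>x\<in>carrier (cyclic_sum ns). x [^]\<^bsub>cyclic_sum ns\<^esub> N = \<one>\<^bsub>cyclic_sum ns\<^esub>)"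
    using gt N by (auto simp: nat_pow_cyclic_sum one_cyclic_sum intro!: restrict_ext)
next
  fix k :: nat
  assume k: "0 < k \<and> (\<forall>x\<in>carrier (cyclic_sum ns). x [^]\<^bsub>cyclic_sum ns\<^esub> k = \<one>\<^bsub>cyclic_sum ns\<^esub>)"
  obtain i where i: "i < length ns" "ns ! i = N"
    using N(1) by (auto simp: in_set_conv_nth)
  have "(std_gen (length ns) i [^]\<^bsub>cyclic_sum ns\<^esub> k) i = \<one>\<^bsub>cyclic_sum ns\<^esub> i"
    using k std_gen_carrier [OF gt] by simp
  with i have "int k mod int N = 0"
    by (simp add: nat_pow_cyclic_sum one_cyclic_sum std_gen_def)
  then have "N dvd k" by presburger
  with k show "N \<le> k" by (simp add: dvd_imp_le)
qed

section \<open>The zero-sum free sequence\<close>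

text \<open>All eight multiplicities turn out to be multiples of \<open>m\<close>. Dividing by
  \<open>m\<close> leaves seven bits and a number \<open>c\<close> with \<open>0 \<le> c\<close> and
  \<open>c < 4\<close>; the congruences modulo \<open>2 * m\<close> become parity checks, and the
  last one ties \<open>c\<close> to the weight of the code word modulo 6.\<close>

lemma block_zero_sum_free:
  fixes m z1 z2 z3 y1 y2 y3 y4 w :: int
  assumes "0 < m" "0 \<le> w" "w < 4 * m"
    and nonneg: "0 \<le> z1" "0 \<le> z2" "0 \<le> z3" "0 \<le> y1" "0 \<le> y2" "0 \<le> y3" "0 \<le> y4"
    and less: "z1 < 2 * m" "z2 < 2 * m" "z3 < 2 * m" "y1 < 2 * m" "y2 < 2 * m" "y3 < 2 * m" "y4 < 2 * m"
    and z: "m dvd z1" "m dvd z2" "m dvd z3"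
    and y: "2 * m dvd y1 + z1 + z2 + z3" "2 * m dvd y2 + z1 + z2"
      "2 * m dvd y3 + z1 + z3" "2 * m dvd y4 + z2 + z3"
    and w: "6 * m dvd w + 2 * (y1 + y2 + y3 + y4 + z1 + z2 + z3)"
  shows "z1 = 0 \<and> z2 = 0 \<and> z3 = 0 \<and> y1 = 0 \<and> y2 = 0 \<and> y3 = 0 \<and> y4 = 0 \<and> w = 0"
proof -
  have "m dvd y1 + z1 + z2 + z3" "m dvd y2 + z1 + z2" "m dvd y3 + z1 + z3" "m dvd y4 + z2 + z3"
    using y dvd_trans [of m "2 * m"] by auto
  with z have y': "m dvd y1" "m dvd y2" "m dvd y3" "m dvd y4"
    by (simp_all add: dvd_add_left_iff)
  have "m dvd w + 2 * (y1 + y2 + y3 + y4 + z1 + z2 + z3)"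
    using w dvd_trans [of m "6 * m"] by auto
  moreover have "m dvd 2 * (y1 + y2 + y3 + y4 + z1 + z2 + z3)"
    using y' z by (intro dvd_mult dvd_add)
  ultimately have "m dvd w"
    by (simp add: dvd_add_left_iff)
  with y' z obtain a1 a2 a3 b1 b2 b3 b4 c where eqs: "z1 = m * a1" "z2 = m * a2" "z3 = m * a3"
    "y1 = m * b1" "y2 = m * b2" "y3 = m * b3" "y4 = m * b4" "w = m * c"
    by (elim dvdE) blast
  have bit: "u \<in> {0, 1}" if "0 \<le> m * u" "m * u < 2 * m" for u
  proof -
    have "0 \<le> u" "u < 2"
      using that \<open>0 < m\<close> by (simp_all add: zero_le_mult_iff mult.commute)
    then show ?thesis by auto
  qed
  have bits: "a1 \<in> {0, 1}" "a2 \<in> {0, 1}" "a3 \<in> {0, 1}"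
    "b1 \<in> {0, 1}" "b2 \<in> {0, 1}" "b3 \<in> {0, 1}" "b4 \<in> {0, 1}"
    using nonneg less unfolding eqs by - (rule bit, assumption+)+
  have c: "0 \<le> c" "c < 4"
  proof -
    have "m * 0 \<le> m * c" "m * c < m * 4"
      using assms(2,3) by (simp_all add: eqs mult.commute)
    then show "0 \<le> c" "c < 4"
      by (simp_all only: mult_le_cancel_left_pos [OF \<open>0 < m\<close>] mult_less_cancel_left_pos [OF \<open>0 < m\<close>])
  qed
  have par: "2 dvd b1 + a1 + a2 + a3" "2 dvd b2 + a1 + a2" "2 dvd b3 + a1 + a3" "2 dvd b4 + a2 + a3"
  proof -
    have "m * 2 dvd m * (b1 + a1 + a2 + a3)" "m * 2 dvd m * (b2 + a1 + a2)"
      "m * 2 dvd m * (b3 + a1 + a3)" "m * 2 dvd m * (b4 + a2 + a3)"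
      using y by (simp_all add: eqs algebra_simps)
    with assms(1) show "2 dvd b1 + a1 + a2 + a3" "2 dvd b2 + a1 + a2"
      "2 dvd b3 + a1 + a3" "2 dvd b4 + a2 + a3"
      by simp_all
  qed
  have six: "6 dvd c + 2 * (b1 + b2 + b3 + b4 + a1 + a2 + a3)"
  proof -
    have "m * 6 dvd m * (c + 2 * (b1 + b2 + b3 + b4 + a1 + a2 + a3))"
      using w by (simp add: eqs algebra_simps)
    with assms(1) show ?thesis by simp
  qed
  \<comment> \<open>The words \<open>(a, b)\<close> form the \<open>[7, 3]\<close> simplex code, whose nonzero words have weight 4.\<close>
  have "b1 + b2 + b3 + b4 + a1 + a2 + a3 \<in> {0, 4}"
  proof -
    have parity: "u = v mod 2" if "u \<in> {0, 1}" "2 dvd u + v" for u v :: int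
      using that by (auto elim!: insertE) presburger+
    \<comment> \<open>The parity checks determine the \<open>b\<close> bits from the three free bits
      \<open>a1\<close>, \<open>a2\<close>, \<open>a3\<close>, so eight cases remain.\<close>
    have "b1 = (a1 + a2 + a3) mod 2" "b2 = (a1 + a2) mod 2" "b3 = (a1 + a3) mod 2" "b4 = (a2 + a3) mod 2"
      using parity [OF bits(4)] parity [OF bits(5)] parity [OF bits(6)] parity [OF bits(7)] par
      by (simp_all only: add.assoc)
    with bits(1-3) show ?thesis by auto
  qed
  \<comment> \<open>Weight 4 would need 6 to divide \<open>c + 8\<close>, hence \<open>c\<close>
    congruent to 4 modulo 6; the range of \<open>c\<close> stops just short of that.\<close>
  moreover have "b1 + b2 + b3 + b4 + a1 + a2 + a3 \<noteq> 4"
    using six c by presburger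
  ultimately have weight: "b1 + b2 + b3 + b4 + a1 + a2 + a3 = 0" by simp
  have "c = 0"
    using six c unfolding weight by presburger
  moreover have "0 \<le> u" if "u \<in> {0, 1}" for u :: int
    using that by auto
  from bits [THEN this]
  have "0 \<le> a1" "0 \<le> a2" "0 \<le> a3" "0 \<le> b1" "0 \<le> b2" "0 \<le> b3" "0 \<le> b4" .
  with weight have "a1 = 0" "a2 = 0" "a3 = 0" "b1 = 0" "b2 = 0" "b3 = 0" "b4 = 0"
    by linarith+
  ultimately show ?thesis
    unfolding eqs by simp
qed

section \<open>Assembling \<open>t\<close> blocks\<close>

definition J_factors :: "nat \<Rightarrow> nat \<Rightarrow> nat list" where
  "J_factors m t = replicate (3 * t) m @ replicate (4 * t) (2 * m) @ replicate t (6 * m)"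

text \<open>Column \<open>s\<close> is the element of \<open>C\<^sub>m\<^sup>3 \<oplus> C\<^sub>2\<^sub>m\<^sup>4 \<oplus> C\<^sub>6\<^sub>m\<close> whose
  multiplicity in \<open>block_zero_sum_free\<close> is, in this order, \<open>z1, z2, z3, y1, y2, y3, y4, w\<close>.\<close>

definition block_matrix :: "int list list" where
  "block_matrix =
    [[1,0,0,0,0,0,0,0],
     [0,1,0,0,0,0,0,0],
     [0,0,1,0,0,0,0,0],
     [1,1,1,1,0,0,0,0],
     [1,1,0,0,1,0,0,0],
     [1,0,1,0,0,1,0,0],
     [0,1,1,0,0,0,1,0],
     [2,2,2,2,2,2,2,1]]"

text \<open>The summands of \<open>J_factors m t\<close> are regrouped into \<open>t\<close> blocks of eight: position \<open>j\<close> is the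
  \<open>snd\<close>-th coordinate of block number \<open>fst\<close>.\<close>

definition block_coord :: "nat \<Rightarrow> nat \<Rightarrow> nat \<times> nat" where
  "block_coord t j =
    (if j < 3 * t then (j div 3, j mod 3)
     else if j < 7 * t then ((j - 3 * t) div 4, 3 + (j - 3 * t) mod 4)
     else (j - 7 * t, 7))"

text \<open>Explicit preimages under \<open>block_coord\<close>: every row of every block occurs as
  a coordinate with the right modulus, so each congruence of a single block can be read off from the
  whole group.\<close>

lemma J_factors_block_coord:
  assumes "k < t" "s < 8"
  obtains j where "j < length (J_factors m t)" "block_coord t j = (k, s)"
    "J_factors m t ! j = (if s < 3 then m else if s < 7 then 2 * m else 6 * m)"
proof -
  consider "s < 3" | "3 \<le> s" "s < 7" | "s = 7" using assms(2) by linarith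
  then show thesis
  proof cases
    case 1
    then show ?thesis
      using assms by (intro that [of "3 * k + s"]) (auto simp: J_factors_def block_coord_def nth_append)
  next
    case 2
    then obtain r where "s = 3 + r" "r < 4"
      using le_Suc_ex by force
    then show ?thesis
      using assms by (intro that [of "3 * t + (4 * k + r)"])
        (auto simp: J_factors_def block_coord_def nth_append)
  next
    case 3
    then show ?thesis
      using assms by (intro that [of "7 * t + k"])
        (auto simp: J_factors_def block_coord_def nth_append)
  qed
qed

lemma davenport_d_J_group_ge:
  assumes "0 < m"
  shows "t * (18 * m - 8) \<le> davenport_d (J_group m t)"
proof -
  define I :: "(nat \<times> nat) set" where "I = {..<t} \<times> {..<8}"
  \<comment> \<open>Multiplicities 1 and 3 of the base sequence become
    \<open>m * (1 + 1) - 1\<close> and \<open>m * (3 + 1) - 1\<close>.\<close>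
  define b :: "nat \<times> nat \<Rightarrow> nat" where "b i = (if snd i = 7 then 4 * m - 1 else 2 * m - 1)" for i
  \<comment> \<open>The block diagonal matrix with \<open>t\<close> copies of
    \<open>block_matrix\<close>.\<close>
  define h :: "nat \<times> nat \<Rightarrow> nat \<Rightarrow> int" where
    "h i j = (if fst (block_coord t j) = fst i
      then block_matrix ! snd (block_coord t j) ! snd i else 0)" for i j
  have "(\<Sum>i\<in>I. b i) \<le> davenport_d (cyclic_sum (J_factors m t))"
  proof (rule davenport_d_cyclic_sum_ge)
    show "\<forall>n\<in>set (J_factors m t). 0 < n"
      using assms by (auto simp: J_factors_def)
    show "finite I" by (simp add: I_def)
    fix x :: "nat \<times> nat \<Rightarrow> nat"
    assume le: "\<And>i. i \<in> I \<Longrightarrow> x i \<le> b i"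
      and dvd: "\<And>j. j < length (J_factors m t) \<Longrightarrow>
        int (J_factors m t ! j) dvd (\<Sum>i\<in>I. int (x i) * h i j)"
    show "\<forall>i\<in>I. x i = 0"
    proof
      fix i assume "i \<in> I"
      then obtain k l where kl: "i = (k, l)" "k < t" "l < 8" by (auto simp: I_def)
      define v where "v s = int (x (k, s))" for s
      \<comment> \<open>At a coordinate of block \<open>k\<close> the terms of all other blocks
        vanish, so the global congruence reduces to row \<open>s\<close> of this block.\<close>
      have rows: "int (if s < 3 then m else if s < 7 then 2 * m else 6 * m)
          dvd (\<Sum>s'<8. v s' * block_matrix ! s ! s')" if s: "s < 8" for s
      proof -
        obtain j where j: "j < length (J_factors m t)" "block_coord t j = (k, s)"
          "J_factors m t ! j = (if s < 3 then m else if s < 7 then 2 * m else 6 * m)"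
          using J_factors_block_coord [OF kl(2) s] by blast
        have "(\<Sum>i\<in>I. int (x i) * h i j)
            = (\<Sum>k'<t. \<Sum>s'<8. int (x (k', s')) * h (k', s') j)"
          by (simp add: I_def sum.cartesian_product)
        also have "\<dots> = (\<Sum>k'<t. if k' = k then \<Sum>s'<8. v s' * block_matrix ! s ! s' else 0)"
          by (intro sum.cong) (auto simp: h_def j(2) v_def)
        also have "\<dots> = (\<Sum>s'<8. v s' * block_matrix ! s ! s')"
          using kl by simp
        finally show ?thesis using dvd [OF j(1)] j(3) by simp
      qed
      have nonneg: "0 \<le> v s" for s by (simp add: v_def)
      have less: "v s < 2 * int m" if "s < 7" for s
        using le [of "(k, s)"] kl that assms by (simp add: I_def b_def v_def)
      have less7: "v 7 < 4 * int m"
        using le [of "(k, 7)"] kl assms by (simp add: I_def b_def v_def)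
      have sum8: "(\<Sum>s<8. f s) = f 0 + f 1 + f 2 + f 3 + f 4 + f 5 + f 6 + f 7" for f :: "nat \<Rightarrow> int"
        by (simp add: eval_nat_numeral)
      have "v 0 = 0 \<and> v 1 = 0 \<and> v 2 = 0 \<and> v 3 = 0 \<and> v 4 = 0 \<and> v 5 = 0 \<and> v 6 = 0 \<and> v 7 = 0"
        using rows [of 0] rows [of 1] rows [of 2] rows [of 3]
          rows [of 4] rows [of 5] rows [of 6] rows [of 7] assms
        by (intro block_zero_sum_free [of "int m"] nonneg less less7)
           (simp_all add: sum8 block_matrix_def algebra_simps)
      moreover have "l \<in> {0, 1, 2, 3, 4, 5, 6, 7}" using kl(3) by auto
      ultimately have "v l = 0" by auto
      then show "x i = 0" by (simp add: v_def kl(1))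
    qed
  qed
  moreover have "(\<Sum>i\<in>I. b i) = t * (18 * m - 8)"
  proof -
    have "(\<Sum>i\<in>I. b i) = (\<Sum>k<t. \<Sum>s<8. b (k, s))"
      by (simp add: I_def sum.cartesian_product)
    also have "\<dots> = t * (7 * (2 * m - 1) + (4 * m - 1))"
      by (simp add: b_def eval_nat_numeral)
    also have "7 * (2 * m - 1) + (4 * m - 1) = 18 * m - 8"
      using assms by simp
    finally show ?thesis .
  qed
  ultimately show ?thesis
    by (simp add: J_group_def J_factors_def)
qed

section \<open>Excess, rank and exponent of \<open>J_group m t\<close>\<close>

theorem mainTheorem6:
  fixes m t :: nat
  assumes "m \<ge> 2" and "t \<ge> 1"
  shows "davenport_excess (J_group m t) \<ge> int (t * m) \<and>
         real (t * m) = real (group_rank (J_group m t) * group_exponent (J_group m t)) / 48"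
proof
  have J: "J_group m t = cyclic_sum (J_factors m t)"
    by (simp add: J_group_def J_factors_def)
  have gt: "\<forall>n\<in>set (J_factors m t). 1 < n"
    using assms by (auto simp: J_factors_def)
  have "sorted_wrt (dvd) (J_factors m t)"
    by (auto simp: J_factors_def sorted_wrt_append sorted_wrt_dvd_replicate)
  with gt have "invariant_factors (J_group m t) (J_factors m t)"
    by (simp add: J invariant_factors_def iso_refl)
  then have "davenport_d_star (J_group m t) = (\<Sum>n\<leftarrow>J_factors m t. n - 1)"
    unfolding J by (intro davenport_d_star_eq comm_group.axioms(2) comm_group_cyclic_sum)
  also have "\<dots> = t * (17 * m - 8)"
  proof -
    have "(\<Sum>n\<leftarrow>J_factors m t. n - 1) = t * (3 * (m - 1) + 4 * (2 * m - 1) + (6 * m - 1))"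
      by (simp add: J_factors_def sum_list_replicate algebra_simps)
    also have "3 * (m - 1) + 4 * (2 * m - 1) + (6 * m - 1) = 17 * m - 8"
      using assms by simp
    finally show ?thesis .
  qed
  \<comment> \<open>Adding \<open>t * m\<close> instead of subtracting avoids truncated subtraction;
    \<open>m \<ge> 2\<close> ensures that \<open>17 * m - 8\<close> is not truncated either.\<close>
  finally have "davenport_d_star (J_group m t) + t * m = t * (17 * m - 8 + m)"
    by (simp add: distrib_left)
  also have "17 * m - 8 + m = 18 * m - 8"
    using assms by simp
  finally have "davenport_d_star (J_group m t) + t * m \<le> davenport_d (J_group m t)"
    using davenport_d_J_group_ge [of m t] assms by simp
  then show "davenport_excess (J_group m t) \<ge> int (t * m)"
    unfolding davenport_excess_def by linarith
  \<comment> \<open>Here \<open>m\<close> itself is the common divisor exceeding 1, and there are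
    \<open>3 * t + 4 * t + t\<close> summands.\<close>
  have "group_rank (J_group m t) = 8 * t"
    using gt assms unfolding J
    by (subst group_rank_cyclic_sum [where m = m]) (auto simp: J_factors_def)
  \<comment> \<open>As \<open>t \<ge> 1\<close>, a summand of order \<open>6 * m\<close> is present.
    The product of rank and exponent is then \<open>8 * t * (6 * m)\<close>, which explains the
    48.\<close>
  moreover have "group_exponent (J_group m t) = 6 * m"
    using gt assms unfolding J
    by (intro group_exponent_cyclic_sum) (auto simp: J_factors_def)
  ultimately show "real (t * m) = real (group_rank (J_group m t) * group_exponent (J_group m t)) / 48"
    by simp
qed

end
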